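(* Let $R$ be a ring. Then the following are equivalent. (i) $R$ is a p.p. ring. (ii) $R$ is a mid ring and $Q(R)$ is a von Neumann regular ring.
   Context: All rings are commutative with identity. $\mathfrak{N}$ denotes the nil-radical of $R$, and $\mathrm{Ann}(a)=\{r\in R: ra=0\}$. $Q(R)$ denotes the total ring of fractions of $R$ (the localization of $R$ at the set of its non-zero-divisors). A p.p. ring is a ring each of whose principal ideals is projective (as a module). An ideal $I$ of $R$ is called N-pure if for every $a\in I$ there exists $b\in I$ such that $a(1-b)\in\mathfrak{N}$. A ring $R$ is called a mid ring if for every $a\in R$, $\mathrm{Ann}(a)$ is an N-pure ideal. *)

theory Defs
  imports "HOL-Algebra.Algebra"
begin

section \<open>Projective modules\<close>

definition mod_hom ::
  "('a, 'r) ring_scheme \<Rightarrow> ('a, 'm, 'x) module_scheme \<Rightarrow> ('a, 'n, 'y) module_scheme \<Rightarrow> ('m \<Rightarrow> 'n) set"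
  where "mod_hom R M N =
    {h \<in> carrier M \<rightarrow> carrier N.
      (\<forall>x\<in>carrier M. \<forall>y\<in>carrier M. h (x \<oplus>\<^bsub>M\<^esub> y) = h x \<oplus>\<^bsub>N\<^esub> h y) \<and>
      (\<forall>r\<in>carrier R. \<forall>x\<in>carrier M. h (r \<odot>\<^bsub>M\<^esub> x) = r \<odot>\<^bsub>N\<^esub> h x)}"

text \<open>
  The lifting property. HOL cannot quantify over the types of the test modules inside a
  definition, so these are fixed: \<open>'m \<Rightarrow> 'a\<close> is large enough to contain the free module on
  the elements of \<open>P\<close>. The lemma \<open>projective_module_lift\<close> below shows that the lifting property
  then holds for test modules over arbitrary types, so nothing is lost by this choice.
\<close>

definition projective_module ::
  "('a, 'r) ring_scheme \<Rightarrow> ('a, 'm, 'x) module_scheme \<Rightarrow> bool"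
  where "projective_module R P \<longleftrightarrow> module R P \<and>
    (\<forall>(N :: ('a, 'm \<Rightarrow> 'a) module) (L :: ('a, 'm) module).
      \<forall>g \<in> mod_hom R N L. \<forall>f \<in> mod_hom R P L.
        module R N \<longrightarrow> module R L \<longrightarrow> g ` carrier N = carrier L \<longrightarrow>
        (\<exists>h \<in> mod_hom R P N. \<forall>x\<in>carrier P. g (h x) = f x))"

definition free_module_on ::
  "('a, 'r) ring_scheme \<Rightarrow> 'm set \<Rightarrow> ('a, 'm \<Rightarrow> 'a) module"
  where "free_module_on R A =
    \<lparr>carrier = {\<phi>. (\<forall>x. \<phi> x \<in> carrier R) \<and> finite {x. \<phi> x \<noteq> \<zero>\<^bsub>R\<^esub>} \<and> {x. \<phi> x \<noteq> \<zero>\<^bsub>R\<^esub>} \<subseteq> A},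
     monoid.mult = undefined, one = undefined,
     ring.zero = (\<lambda>_. \<zero>\<^bsub>R\<^esub>), add = (\<lambda>\<phi> \<psi> x. \<phi> x \<oplus>\<^bsub>R\<^esub> \<psi> x),
     smult = (\<lambda>r \<phi> x. r \<otimes>\<^bsub>R\<^esub> \<phi> x)\<rparr>"

lemma free_module_on_module:
  fixes R :: "('a, 'r) ring_scheme" and A :: "'m set"
  assumes "cring R"
  shows "module R (free_module_on R A)"
proof -
  interpret cring R by fact
  have supp_add: "{x. \<phi> x \<oplus>\<^bsub>R\<^esub> \<psi> x \<noteq> \<zero>\<^bsub>R\<^esub>} \<subseteq> {x. \<phi> x \<noteq> \<zero>\<^bsub>R\<^esub>} \<union> {x. \<psi> x \<noteq> \<zero>\<^bsub>R\<^esub>}" for \<phi> \<psi> :: "'m \<Rightarrow> 'a"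
    by auto
  have add_cl: "\<phi> \<oplus>\<^bsub>free_module_on R A\<^esub> \<psi> \<in> carrier (free_module_on R A)"
    if "\<phi> \<in> carrier (free_module_on R A)" "\<psi> \<in> carrier (free_module_on R A)" for \<phi> \<psi>
  proof -
    have "{x. \<phi> x \<noteq> \<zero>\<^bsub>R\<^esub>} \<union> {x. \<psi> x \<noteq> \<zero>\<^bsub>R\<^esub>} \<subseteq> A" "finite ({x. \<phi> x \<noteq> \<zero>\<^bsub>R\<^esub>} \<union> {x. \<psi> x \<noteq> \<zero>\<^bsub>R\<^esub>})"
      using that by (simp_all add: free_module_on_def)
    from subset_trans[OF supp_add this(1)] finite_subset[OF supp_add this(2)]
    show ?thesis using that by (simp add: free_module_on_def)
  qed
  have fin_smult: "finite {x. r \<otimes>\<^bsub>R\<^esub> \<phi> x \<noteq> \<zero>\<^bsub>R\<^esub>}"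
    if "finite {x. \<phi> x \<noteq> \<zero>\<^bsub>R\<^esub>}" "r \<in> carrier R" for r and \<phi> :: "'m \<Rightarrow> 'a"
    by (rule finite_subset[OF _ that(1)]) (use that in auto)
  have ab: "abelian_group (free_module_on R A)"
  proof (rule abelian_groupI)
    fix \<phi> assume p: "\<phi> \<in> carrier (free_module_on R A)"
    have "(\<lambda>x. \<ominus>\<^bsub>R\<^esub> \<phi> x) \<in> carrier (free_module_on R A)"
    proof -
      have "{x. \<ominus>\<^bsub>R\<^esub> \<phi> x \<noteq> \<zero>\<^bsub>R\<^esub>} \<subseteq> {x. \<phi> x \<noteq> \<zero>\<^bsub>R\<^esub>}"
        using p by (auto simp: free_module_on_def)
      then show ?thesis using p by (auto simp: free_module_on_def intro: finite_subset)
    qed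
    moreover have "(\<lambda>x. \<ominus>\<^bsub>R\<^esub> \<phi> x) \<oplus>\<^bsub>free_module_on R A\<^esub> \<phi> = \<zero>\<^bsub>free_module_on R A\<^esub>"
      using p by (auto simp: free_module_on_def l_neg)
    ultimately show "\<exists>y\<in>carrier (free_module_on R A).
        y \<oplus>\<^bsub>free_module_on R A\<^esub> \<phi> = \<zero>\<^bsub>free_module_on R A\<^esub>" by blast
  qed (rule add_cl, assumption+, auto simp: free_module_on_def a_ac)
  show ?thesis
    by (rule moduleI[OF assms ab])
      (auto simp: free_module_on_def fin_smult l_distr r_distr m_assoc)
qed

definition free_eval ::
  "('a, 'r) ring_scheme \<Rightarrow> ('a, 'n, 'y) module_scheme \<Rightarrow> ('m \<Rightarrow> 'n) \<Rightarrow> ('m \<Rightarrow> 'a) \<Rightarrow> 'n"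
  where "free_eval R N e \<phi> = finsum N (\<lambda>x. \<phi> x \<odot>\<^bsub>N\<^esub> e x) {x. \<phi> x \<noteq> \<zero>\<^bsub>R\<^esub>}"

lemma free_eval_superset:
  assumes "module R N" "e \<in> A \<rightarrow> carrier N" "\<phi> \<in> carrier (free_module_on R A)"
    and "finite B" "{x. \<phi> x \<noteq> \<zero>\<^bsub>R\<^esub>} \<subseteq> B" "B \<subseteq> A"
  shows "free_eval R N e \<phi> = finsum N (\<lambda>x. \<phi> x \<odot>\<^bsub>N\<^esub> e x) B"
proof -
  interpret module R N by fact
  have "e x \<in> carrier N" if "x \<in> B" for x using assms(2,6) that by auto
  then show ?thesis unfolding free_eval_def
    by (intro M.add.finprod_mono_neutral_cong_left)
      (use assms in \<open>auto simp: free_module_on_def\<close>)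
qed

lemma free_eval_hom:
  assumes "module R N" "e \<in> A \<rightarrow> carrier N"
  shows "free_eval R N e \<in> mod_hom R (free_module_on R A) N"
proof -
  interpret module R N by fact
  interpret F: module R "free_module_on R A"
    by (rule free_module_on_module) (rule R.cring_axioms)
  let ?F = "free_module_on R A"
  note sup = free_eval_superset[OF assms]
  have car: "\<phi> x \<in> carrier R" if "\<phi> \<in> carrier ?F" for \<phi> x
    using that by (simp add: free_module_on_def)
  have fin: "finite {x. \<phi> x \<noteq> \<zero>\<^bsub>R\<^esub>}" "{x. \<phi> x \<noteq> \<zero>\<^bsub>R\<^esub>} \<subseteq> A" if "\<phi> \<in> carrier ?F" for \<phi>
    using that by (auto simp: free_module_on_def)
  have clos: "free_eval R N e \<phi> \<in> carrier N" if "\<phi> \<in> carrier ?F" for \<phi>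
    unfolding free_eval_def
    by (rule M.finsum_closed) (use assms that fin(2)[OF that] in \<open>auto intro!: smult_closed car\<close>)
  have add: "free_eval R N e (\<phi> \<oplus>\<^bsub>?F\<^esub> \<psi>) = free_eval R N e \<phi> \<oplus>\<^bsub>N\<^esub> free_eval R N e \<psi>"
    if p: "\<phi> \<in> carrier ?F" and q: "\<psi> \<in> carrier ?F" for \<phi> \<psi>
  proof -
    let ?B = "{x. \<phi> x \<noteq> \<zero>\<^bsub>R\<^esub>} \<union> {x. \<psi> x \<noteq> \<zero>\<^bsub>R\<^esub>}"
    have B: "finite ?B" "?B \<subseteq> A" using fin[OF p] fin[OF q] by auto
    have e: "e x \<in> carrier N" if "x \<in> ?B" for x using that B assms by blast
    have "free_eval R N e (\<phi> \<oplus>\<^bsub>?F\<^esub> \<psi>) = finsum N (\<lambda>x. (\<phi> x \<oplus>\<^bsub>R\<^esub> \<psi> x) \<odot>\<^bsub>N\<^esub> e x) ?B"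
      by (subst sup[of _ ?B]) (use F.add.m_closed[OF p q] B in \<open>auto simp: free_module_on_def\<close>)
    also have "\<dots> = finsum N (\<lambda>x. \<phi> x \<odot>\<^bsub>N\<^esub> e x \<oplus>\<^bsub>N\<^esub> \<psi> x \<odot>\<^bsub>N\<^esub> e x) ?B"
      by (rule M.finsum_cong') (use e car p q in \<open>auto simp: smult_l_distr\<close>)
    also have "\<dots> = finsum N (\<lambda>x. \<phi> x \<odot>\<^bsub>N\<^esub> e x) ?B \<oplus>\<^bsub>N\<^esub> finsum N (\<lambda>x. \<psi> x \<odot>\<^bsub>N\<^esub> e x) ?B"
      by (rule M.finsum_addf) (use e car p q in auto)
    also have "\<dots> = free_eval R N e \<phi> \<oplus>\<^bsub>N\<^esub> free_eval R N e \<psi>"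
      using sup[OF p B(1) _ B(2)] sup[OF q B(1) _ B(2)] by simp
    finally show ?thesis .
  qed
  have sm: "free_eval R N e (r \<odot>\<^bsub>?F\<^esub> \<phi>) = r \<odot>\<^bsub>N\<^esub> free_eval R N e \<phi>"
    if r: "r \<in> carrier R" and p: "\<phi> \<in> carrier ?F" for r \<phi>
  proof -
    let ?B = "{x. \<phi> x \<noteq> \<zero>\<^bsub>R\<^esub>}"
    have B: "finite ?B" "?B \<subseteq> A" using fin[OF p] by auto
    have e: "e x \<in> carrier N" if "x \<in> ?B" for x using that B assms by blast
    have "free_eval R N e (r \<odot>\<^bsub>?F\<^esub> \<phi>) = finsum N (\<lambda>x. (r \<otimes>\<^bsub>R\<^esub> \<phi> x) \<odot>\<^bsub>N\<^esub> e x) ?B"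
      by (subst sup[of _ ?B]) (use F.smult_closed[OF r p] B r in \<open>auto simp: free_module_on_def\<close>)
    also have "\<dots> = finsum N (\<lambda>x. r \<odot>\<^bsub>N\<^esub> (\<phi> x \<odot>\<^bsub>N\<^esub> e x)) ?B"
      by (rule M.finsum_cong') (use e car p r in \<open>auto simp: smult_assoc1\<close>)
    also have "\<dots> = r \<odot>\<^bsub>N\<^esub> free_eval R N e \<phi>"
      unfolding free_eval_def
      by (rule finsum_smult_ldistr[symmetric]) (use e car p r B in auto)
    finally show ?thesis .
  qed
  show ?thesis using clos add sm by (auto simp: mod_hom_def)
qed

lemma mod_hom_zero:
  assumes "module R M" "module R N" "h \<in> mod_hom R M N"
  shows "h \<zero>\<^bsub>M\<^esub> = \<zero>\<^bsub>N\<^esub>"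
proof -
  interpret M: module R M by fact
  interpret N: module R N by fact
  have "h (\<zero>\<^bsub>R\<^esub> \<odot>\<^bsub>M\<^esub> \<zero>\<^bsub>M\<^esub>) = \<zero>\<^bsub>R\<^esub> \<odot>\<^bsub>N\<^esub> h \<zero>\<^bsub>M\<^esub>" "h \<zero>\<^bsub>M\<^esub> \<in> carrier N"
    using assms(3) by (simp_all add: mod_hom_def Pi_iff del: M.smult_r_null M.smult_l_null)
  then show ?thesis by simp
qed

lemma mod_hom_finsum:
  assumes "module R M" "module R N" "h \<in> mod_hom R M N" "finite B" "k \<in> B \<rightarrow> carrier M"
  shows "h (finsum M k B) = finsum N (\<lambda>x. h (k x)) B"
proof -
  interpret M: module R M by fact
  interpret N: module R N by fact
  have hc: "h x \<in> carrier N" if "x \<in> carrier M" for x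
    using assms(3) that unfolding mod_hom_def by auto
  have ha: "h (x \<oplus>\<^bsub>M\<^esub> y) = h x \<oplus>\<^bsub>N\<^esub> h y" if "x \<in> carrier M" "y \<in> carrier M" for x y
    using assms(3) that unfolding mod_hom_def by auto
  show ?thesis using assms(4,5)
  proof (induction B)
    case empty
    then show ?case using mod_hom_zero[OF assms(1-3)] by simp
  next
    case (insert x B)
    then have "k \<in> B \<rightarrow> carrier M" "k x \<in> carrier M" by auto
    moreover from this have "(\<lambda>x. h (k x)) \<in> B \<rightarrow> carrier N" using hc by auto
    ultimately show ?case using insert hc by (simp add: ha)
  qed
qed

lemma projective_module_lift:
  fixes N :: "('a, 'n, 'y) module_scheme" and L :: "('a, 'l, 'z) module_scheme"
  assumes P: "projective_module R P"
    and N: "module R N" and L: "module R L"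
    and g: "g \<in> mod_hom R N L" "g ` carrier N = carrier L"
    and f: "f \<in> mod_hom R P L"
  shows "\<exists>h \<in> mod_hom R P N. \<forall>x\<in>carrier P. g (h x) = f x"
proof -
  have mP: "module R P" using P by (simp add: projective_module_def)
  interpret P: module R P by fact
  interpret N: module R N by fact
  interpret L: module R L by fact
  let ?A = "carrier P"
  let ?F = "free_module_on R ?A"
  have mF: "module R ?F" by (rule free_module_on_module) (rule P.R.cring_axioms)
  let ?P = "module.truncate P"
  have tr: "carrier ?P = carrier P" "x \<oplus>\<^bsub>?P\<^esub> y = x \<oplus>\<^bsub>P\<^esub> y" "\<zero>\<^bsub>?P\<^esub> = \<zero>\<^bsub>P\<^esub>"
      "r \<odot>\<^bsub>?P\<^esub> x = r \<odot>\<^bsub>P\<^esub> x" for x y r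
    by (simp_all add: module.truncate_def)
  have mP': "module R ?P"
  proof (rule moduleI)
    show "abelian_group ?P"
    proof (rule abelian_groupI, unfold tr)
      fix x assume "x \<in> carrier P"
      then show "\<exists>y\<in>carrier P. y \<oplus>\<^bsub>P\<^esub> x = \<zero>\<^bsub>P\<^esub>"
        by (intro bexI[of _ "\<ominus>\<^bsub>P\<^esub> x"]) (simp_all add: P.M.l_neg)
    qed (simp_all add: P.M.a_ac)
  qed (simp_all add: tr P.R.cring_axioms P.smult_l_distr P.smult_r_distr P.smult_assoc1)
  have p: "free_eval R P (\<lambda>x. x) \<in> mod_hom R ?F P"
    by (rule free_eval_hom[OF mP]) auto
  have p': "free_eval R P (\<lambda>x. x) \<in> mod_hom R ?F ?P"
    using p by (simp add: mod_hom_def tr)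
  have surj: "free_eval R P (\<lambda>x. x) ` carrier ?F = carrier ?P"
  proof
    show "free_eval R P (\<lambda>x. x) ` carrier ?F \<subseteq> carrier ?P"
      using p' by (auto simp: mod_hom_def)
    show "carrier ?P \<subseteq> free_eval R P (\<lambda>x. x) ` carrier ?F"
    proof
      fix m assume "m \<in> carrier ?P"
      then have m: "m \<in> carrier P" by (simp add: tr)
      let ?\<delta> = "\<lambda>x. if x = m then \<one>\<^bsub>R\<^esub> else \<zero>\<^bsub>R\<^esub>"
      have d: "?\<delta> \<in> carrier ?F"
        using m by (simp add: free_module_on_def) (simp add: subset_iff)
      have "free_eval R P (\<lambda>x. x) ?\<delta> = finsum P (\<lambda>x. ?\<delta> x \<odot>\<^bsub>P\<^esub> x) {m}"
        by (rule free_eval_superset[OF mP _ d]) (use m in auto)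
      also have "\<dots> = m" using m by simp
      finally show "m \<in> free_eval R P (\<lambda>x. x) ` carrier ?F" using d by force
    qed
  qed
  have "(\<lambda>x. x) \<in> mod_hom R P ?P" by (auto simp: mod_hom_def tr)
  then obtain s where s: "s \<in> mod_hom R P ?F" "\<And>x. x \<in> carrier P \<Longrightarrow> free_eval R P (\<lambda>x. x) (s x) = x"
    using P[unfolded projective_module_def, THEN conjunct2, rule_format, OF p' _ mF mP' surj]
    by blast
  have "\<forall>x\<in>carrier P. \<exists>n\<in>carrier N. g n = f x"
  proof
    fix x assume "x \<in> carrier P"
    then have "f x \<in> g ` carrier N" unfolding g(2) using f by (auto simp: mod_hom_def)
    then show "\<exists>n\<in>carrier N. g n = f x" by force
  qed
  then obtain e where e: "\<And>x. x \<in> carrier P \<Longrightarrow> e x \<in> carrier N" "\<And>x. x \<in> carrier P \<Longrightarrow> g (e x) = f x"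
    by metis
  have k: "free_eval R N e \<in> mod_hom R ?F N"
    by (rule free_eval_hom[OF N]) (use e in auto)
  have comm: "g (free_eval R N e \<phi>) = f (free_eval R P (\<lambda>x. x) \<phi>)" if "\<phi> \<in> carrier ?F" for \<phi>
  proof -
    let ?B = "{x. \<phi> x \<noteq> \<zero>\<^bsub>R\<^esub>}"
    have c: "finite ?B" "\<And>x. \<phi> x \<in> carrier R" "\<And>x. x \<in> ?B \<Longrightarrow> x \<in> carrier P"
      using that by (auto simp: free_module_on_def)
    have "g (free_eval R N e \<phi>) = finsum L (\<lambda>x. g (\<phi> x \<odot>\<^bsub>N\<^esub> e x)) ?B"
      unfolding free_eval_def
      by (rule mod_hom_finsum[OF N L g(1)]) (use c e in auto)
    also have "\<dots> = finsum L (\<lambda>x. f (\<phi> x \<odot>\<^bsub>P\<^esub> x)) ?B"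
      by (rule L.M.finsum_cong') (use c e f g(1) in \<open>auto simp: mod_hom_def Pi_iff\<close>)
    also have "\<dots> = f (free_eval R P (\<lambda>x. x) \<phi>)"
      unfolding free_eval_def
      by (rule mod_hom_finsum[OF mP L f, symmetric]) (use c in auto)
    finally show ?thesis .
  qed
  show ?thesis
  proof (rule bexI)
    show "\<forall>x\<in>carrier P. g (free_eval R N e (s x)) = f x"
      using comm s by (auto simp: mod_hom_def Pi_iff)
    show "(\<lambda>x. free_eval R N e (s x)) \<in> mod_hom R P N"
      using k s(1) by (auto simp: mod_hom_def Pi_iff)
  qed
qed


section \<open>P.p. rings\<close>

text \<open>\<open>(regular_module R)\<lparr>carrier := I\<rparr>\<close> is an ideal \<open>I\<close> of \<open>R\<close> regarded as an \<open>R\<close>-module.\<close>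

definition regular_module :: "('a, 'r) ring_scheme \<Rightarrow> ('a, 'a) module"
  where "regular_module R =
    \<lparr>carrier = carrier R, monoid.mult = (\<otimes>\<^bsub>R\<^esub>), one = \<one>\<^bsub>R\<^esub>,
     ring.zero = \<zero>\<^bsub>R\<^esub>, add = (\<oplus>\<^bsub>R\<^esub>), smult = (\<otimes>\<^bsub>R\<^esub>)\<rparr>"

definition pp_ring :: "('a, 'r) ring_scheme \<Rightarrow> bool"
  where "pp_ring R \<longleftrightarrow> cring R \<and>
    (\<forall>I. principalideal I R \<longrightarrow> projective_module R ((regular_module R)\<lparr>carrier := I\<rparr>))"


section \<open>Mid rings\<close>

definition nilradical :: "('a, 'r) ring_scheme \<Rightarrow> 'a set"
  where "nilradical R = {x \<in> carrier R. \<exists>n::nat. x [^]\<^bsub>R\<^esub> n = \<zero>\<^bsub>R\<^esub>}"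

definition Ann :: "('a, 'r) ring_scheme \<Rightarrow> 'a \<Rightarrow> 'a set"
  where "Ann R a = {r \<in> carrier R. r \<otimes>\<^bsub>R\<^esub> a = \<zero>\<^bsub>R\<^esub>}"

definition N_pure :: "('a, 'r) ring_scheme \<Rightarrow> 'a set \<Rightarrow> bool"
  where "N_pure R I \<longleftrightarrow> ideal I R \<and>
    (\<forall>a\<in>I. \<exists>b\<in>I. a \<otimes>\<^bsub>R\<^esub> (\<one>\<^bsub>R\<^esub> \<ominus>\<^bsub>R\<^esub> b) \<in> nilradical R)"

definition mid_ring :: "('a, 'r) ring_scheme \<Rightarrow> bool"
  where "mid_ring R \<longleftrightarrow> cring R \<and> (\<forall>a\<in>carrier R. N_pure R (Ann R a))"


section \<open>The total ring of fractions\<close>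

definition frac_rel :: "('a, 'r) ring_scheme \<Rightarrow> 'a set \<Rightarrow> (('a \<times> 'a) \<times> ('a \<times> 'a)) set"
  where "frac_rel R S = {((a, s), (b, t)).
    a \<in> carrier R \<and> s \<in> S \<and> b \<in> carrier R \<and> t \<in> S \<and>
    (\<exists>u\<in>S. u \<otimes>\<^bsub>R\<^esub> (a \<otimes>\<^bsub>R\<^esub> t) = u \<otimes>\<^bsub>R\<^esub> (b \<otimes>\<^bsub>R\<^esub> s))}"

text \<open>\<open>fraction R S a s\<close> is the fraction \<open>a/s\<close>.\<close>

definition fraction :: "('a, 'r) ring_scheme \<Rightarrow> 'a set \<Rightarrow> 'a \<Rightarrow> 'a \<Rightarrow> ('a \<times> 'a) set"
  where "fraction R S a s = frac_rel R S `` {(a, s)}"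

text \<open>
  The unions in the operations range over equal sets, by independence of the representatives;
  see \<open>localization_add\<close> and \<open>localization_mult\<close>.
\<close>

definition localization :: "('a, 'r) ring_scheme \<Rightarrow> 'a set \<Rightarrow> ('a \<times> 'a) set ring"
  where "localization R S =
    \<lparr>carrier = (carrier R \<times> S) // frac_rel R S,
     monoid.mult = (\<lambda>W Y. \<Union>(a, s)\<in>W. \<Union>(b, t)\<in>Y. fraction R S (a \<otimes>\<^bsub>R\<^esub> b) (s \<otimes>\<^bsub>R\<^esub> t)),
     one = fraction R S \<one>\<^bsub>R\<^esub> \<one>\<^bsub>R\<^esub>,
     ring.zero = fraction R S \<zero>\<^bsub>R\<^esub> \<one>\<^bsub>R\<^esub>,
     add = (\<lambda>W Y. \<Union>(a, s)\<in>W. \<Union>(b, t)\<in>Y.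
       fraction R S (a \<otimes>\<^bsub>R\<^esub> t \<oplus>\<^bsub>R\<^esub> b \<otimes>\<^bsub>R\<^esub> s) (s \<otimes>\<^bsub>R\<^esub> t))\<rparr>"

definition nonzerodivisors :: "('a, 'r) ring_scheme \<Rightarrow> 'a set"
  where "nonzerodivisors R =
    {s \<in> carrier R. \<forall>r\<in>carrier R. r \<otimes>\<^bsub>R\<^esub> s = \<zero>\<^bsub>R\<^esub> \<longrightarrow> r = \<zero>\<^bsub>R\<^esub>}"

definition total_fraction_ring :: "('a, 'r) ring_scheme \<Rightarrow> ('a \<times> 'a) set ring"
  where "total_fraction_ring R = localization R (nonzerodivisors R)"

definition von_neumann_regular :: "('a, 'r) ring_scheme \<Rightarrow> bool"
  where "von_neumann_regular R \<longleftrightarrow> ring R \<and>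
    (\<forall>a\<in>carrier R. \<exists>b\<in>carrier R. a = a \<otimes>\<^bsub>R\<^esub> b \<otimes>\<^bsub>R\<^esub> a)"

locale mult_set = cring R for R (structure) +
  fixes S :: "'a set"
  assumes S_subset: "S \<subseteq> carrier R"
    and S_one: "\<one> \<in> S"
    and S_mult: "\<And>s t. s \<in> S \<Longrightarrow> t \<in> S \<Longrightarrow> s \<otimes> t \<in> S"
begin

lemma S_carrier [simp]: "s \<in> S \<Longrightarrow> s \<in> carrier R"
  using S_subset by blast

lemma frac_rel_equiv: "equiv (carrier R \<times> S) (frac_rel R S)"
proof (rule equivI)
  show "frac_rel R S \<subseteq> (carrier R \<times> S) \<times> (carrier R \<times> S)"
    by (auto simp: frac_rel_def)
  show "refl_on (carrier R \<times> S) (frac_rel R S)"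
    using S_one by (auto simp: frac_rel_def refl_on_def)
  show "sym (frac_rel R S)"
    by (auto simp: frac_rel_def sym_def) metis
  show "trans (frac_rel R S)"
  proof (rule transI, clarsimp simp: frac_rel_def)
    fix a s b t c w u v
    assume c: "a \<in> carrier R" "s \<in> S" "b \<in> carrier R" "t \<in> S" "c \<in> carrier R" "w \<in> S" "u \<in> S" "v \<in> S"
      and e1: "u \<otimes> (a \<otimes> t) = u \<otimes> (b \<otimes> s)" and e2: "v \<otimes> (b \<otimes> w) = v \<otimes> (c \<otimes> t)"
    have "(u \<otimes> v \<otimes> t) \<otimes> (a \<otimes> w) = v \<otimes> w \<otimes> (u \<otimes> (a \<otimes> t))" using c by (simp add: m_ac)
    also have "\<dots> = u \<otimes> s \<otimes> (v \<otimes> (b \<otimes> w))" unfolding e1 using c by (simp add: m_ac)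
    also have "\<dots> = (u \<otimes> v \<otimes> t) \<otimes> (c \<otimes> s)" unfolding e2 using c by (simp add: m_ac)
    finally show "\<exists>u\<in>S. u \<otimes> (a \<otimes> w) = u \<otimes> (c \<otimes> s)" using c S_mult by blast
  qed
qed

lemma frac_eq_iff:
  assumes "a \<in> carrier R" "s \<in> S" "b \<in> carrier R" "t \<in> S"
  shows "fraction R S a s = fraction R S b t \<longleftrightarrow> (\<exists>u\<in>S. u \<otimes> (a \<otimes> t) = u \<otimes> (b \<otimes> s))"
  unfolding fraction_def
  by (subst eq_equiv_class_iff[OF frac_rel_equiv]) (use assms in \<open>auto simp: frac_rel_def\<close>)

lemma frac_carrier [simp]:
  "a \<in> carrier R \<Longrightarrow> s \<in> S \<Longrightarrow> fraction R S a s \<in> carrier (localization R S)"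
  by (auto simp: localization_def fraction_def intro!: quotientI)

lemma localization_cases:
  assumes "W \<in> carrier (localization R S)"
  obtains a s where "a \<in> carrier R" "s \<in> S" "W = fraction R S a s"
  using assms by (auto simp: localization_def fraction_def elim!: quotientE)

lemma frac_eqI:
  assumes "a \<in> carrier R" "s \<in> S" "b \<in> carrier R" "t \<in> S" "a \<otimes> t = b \<otimes> s"
  shows "fraction R S a s = fraction R S b t"
  using assms S_one by (subst frac_eq_iff) auto

lemma localization_mult:
  assumes c: "a \<in> carrier R" "s \<in> S" "b \<in> carrier R" "t \<in> S"
  shows "fraction R S a s \<otimes>\<^bsub>localization R S\<^esub> fraction R S b t = fraction R S (a \<otimes> b) (s \<otimes> t)"
proof -
  have *: "fraction R S (a' \<otimes> b') (s' \<otimes> t') = fraction R S (a \<otimes> b) (s \<otimes> t)"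
    if h: "(a', s') \<in> fraction R S a s" "(b', t') \<in> fraction R S b t" for a' s' b' t'
  proof -
    from h obtain u v where d: "a' \<in> carrier R" "s' \<in> S" "b' \<in> carrier R" "t' \<in> S" "u \<in> S" "v \<in> S"
      and e: "u \<otimes> (a \<otimes> s') = u \<otimes> (a' \<otimes> s)" "v \<otimes> (b \<otimes> t') = v \<otimes> (b' \<otimes> t)"
      by (auto simp: fraction_def frac_rel_def)
    have "(u \<otimes> v) \<otimes> ((a' \<otimes> b') \<otimes> (s \<otimes> t)) = (u \<otimes> (a' \<otimes> s)) \<otimes> (v \<otimes> (b' \<otimes> t))"
      using c d by (simp add: m_ac)
    also have "\<dots> = (u \<otimes> v) \<otimes> ((a \<otimes> b) \<otimes> (s' \<otimes> t'))"
      unfolding e[symmetric] using c d by (simp add: m_ac)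
    finally show ?thesis using c d S_mult by (subst frac_eq_iff) auto
  qed
  have m: "(a, s) \<in> fraction R S a s" "(b, t) \<in> fraction R S b t"
    using c S_one by (auto simp: fraction_def frac_rel_def)
  have "(\<Union>(a', s')\<in>fraction R S a s. \<Union>(b', t')\<in>fraction R S b t. fraction R S (a' \<otimes> b') (s' \<otimes> t'))
      = fraction R S (a \<otimes> b) (s \<otimes> t)" (is "?U = _")
  proof
    show "?U \<subseteq> fraction R S (a \<otimes> b) (s \<otimes> t)" using * by blast
    show "fraction R S (a \<otimes> b) (s \<otimes> t) \<subseteq> ?U" using m by blast
  qed
  then show ?thesis by (simp add: localization_def)
qed

lemma localization_add:
  assumes c: "a \<in> carrier R" "s \<in> S" "b \<in> carrier R" "t \<in> S"
  shows "fraction R S a s \<oplus>\<^bsub>localization R S\<^esub> fraction R S b t = fraction R S (a \<otimes> t \<oplus> b \<otimes> s) (s \<otimes> t)"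
proof -
  have *: "fraction R S (a' \<otimes> t' \<oplus> b' \<otimes> s') (s' \<otimes> t') = fraction R S (a \<otimes> t \<oplus> b \<otimes> s) (s \<otimes> t)"
    if h: "(a', s') \<in> fraction R S a s" "(b', t') \<in> fraction R S b t" for a' s' b' t'
  proof -
    from h obtain u v where d: "a' \<in> carrier R" "s' \<in> S" "b' \<in> carrier R" "t' \<in> S" "u \<in> S" "v \<in> S"
      and e: "u \<otimes> (a \<otimes> s') = u \<otimes> (a' \<otimes> s)" "v \<otimes> (b \<otimes> t') = v \<otimes> (b' \<otimes> t)"
      by (auto simp: fraction_def frac_rel_def)
    have "(u \<otimes> v) \<otimes> ((a' \<otimes> t' \<oplus> b' \<otimes> s') \<otimes> (s \<otimes> t))
        = v \<otimes> t \<otimes> t' \<otimes> (u \<otimes> (a' \<otimes> s)) \<oplus> u \<otimes> s \<otimes> s' \<otimes> (v \<otimes> (b' \<otimes> t))"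
      using c d by (simp add: l_distr r_distr m_ac)
    also have "\<dots> = (u \<otimes> v) \<otimes> ((a \<otimes> t \<oplus> b \<otimes> s) \<otimes> (s' \<otimes> t'))"
      unfolding e[symmetric] using c d by (simp add: l_distr r_distr m_ac)
    finally show ?thesis using c d S_mult by (subst frac_eq_iff) auto
  qed
  have m: "(a, s) \<in> fraction R S a s" "(b, t) \<in> fraction R S b t"
    using c S_one by (auto simp: fraction_def frac_rel_def)
  have "(\<Union>(a', s')\<in>fraction R S a s. \<Union>(b', t')\<in>fraction R S b t.
        fraction R S (a' \<otimes> t' \<oplus> b' \<otimes> s') (s' \<otimes> t'))
      = fraction R S (a \<otimes> t \<oplus> b \<otimes> s) (s \<otimes> t)" (is "?U = _")
  proof
    show "?U \<subseteq> fraction R S (a \<otimes> t \<oplus> b \<otimes> s) (s \<otimes> t)" using * by blast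
    show "fraction R S (a \<otimes> t \<oplus> b \<otimes> s) (s \<otimes> t) \<subseteq> ?U" using m by blast
  qed
  then show ?thesis by (simp add: localization_def)
qed

lemma localization_one: "\<one>\<^bsub>localization R S\<^esub> = fraction R S \<one> \<one>"
  and localization_zero: "\<zero>\<^bsub>localization R S\<^esub> = fraction R S \<zero> \<one>"
  by (simp_all add: localization_def)

lemma localization_cring: "cring (localization R S)"
proof (rule cringI)
  let ?Q = "localization R S"
  note ops = localization_add localization_mult localization_one localization_zero
  show "abelian_group ?Q"
  proof (rule abelian_groupI)
    fix W Y assume "W \<in> carrier ?Q" "Y \<in> carrier ?Q"
    then obtain a s b t where c: "a \<in> carrier R" "s \<in> S" "W = fraction R S a s"
        "b \<in> carrier R" "t \<in> S" "Y = fraction R S b t"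
      by (meson localization_cases)
    then show "W \<oplus>\<^bsub>?Q\<^esub> Y \<in> carrier ?Q" by (simp add: ops S_mult)
    from c show "W \<oplus>\<^bsub>?Q\<^esub> Y = Y \<oplus>\<^bsub>?Q\<^esub> W" by (simp add: ops S_mult m_comm a_comm)
    fix Z assume "Z \<in> carrier ?Q"
    then obtain d w where "d \<in> carrier R" "w \<in> S" "Z = fraction R S d w" by (meson localization_cases)
    with c show "W \<oplus>\<^bsub>?Q\<^esub> Y \<oplus>\<^bsub>?Q\<^esub> Z = W \<oplus>\<^bsub>?Q\<^esub> (Y \<oplus>\<^bsub>?Q\<^esub> Z)"
      by (simp add: ops S_mult l_distr r_distr m_ac a_ac)
  next
    show "\<zero>\<^bsub>?Q\<^esub> \<in> carrier ?Q" using S_one by (simp add: ops)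
    fix W assume "W \<in> carrier ?Q"
    then obtain a s where c: "a \<in> carrier R" "s \<in> S" "W = fraction R S a s"
      by (meson localization_cases)
    then show "\<zero>\<^bsub>?Q\<^esub> \<oplus>\<^bsub>?Q\<^esub> W = W" using S_one by (simp add: ops)
    have "fraction R S (\<ominus> a) s \<oplus>\<^bsub>?Q\<^esub> W = \<zero>\<^bsub>?Q\<^esub>"
      unfolding c(3) localization_zero using c(1,2) S_one
      by (subst localization_add)
        (simp_all add: l_distr[symmetric] l_neg del: l_distr, intro frac_eqI, simp_all add: S_mult)
    then show "\<exists>Y\<in>carrier ?Q. Y \<oplus>\<^bsub>?Q\<^esub> W = \<zero>\<^bsub>?Q\<^esub>" using c by (metis a_inv_closed frac_carrier)
  qed
  show "Group.comm_monoid ?Q"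
  proof (rule comm_monoidI)
    show "\<one>\<^bsub>?Q\<^esub> \<in> carrier ?Q" using S_one by (simp add: ops)
    fix W Y assume "W \<in> carrier ?Q" "Y \<in> carrier ?Q"
    then obtain a s b t where c: "a \<in> carrier R" "s \<in> S" "W = fraction R S a s"
        "b \<in> carrier R" "t \<in> S" "Y = fraction R S b t"
      by (meson localization_cases)
    then show "W \<otimes>\<^bsub>?Q\<^esub> Y \<in> carrier ?Q" by (simp add: ops S_mult)
    from c show "W \<otimes>\<^bsub>?Q\<^esub> Y = Y \<otimes>\<^bsub>?Q\<^esub> W" by (simp add: ops m_comm)
    from c show "\<one>\<^bsub>?Q\<^esub> \<otimes>\<^bsub>?Q\<^esub> W = W" using S_one by (simp add: ops)
    fix Z assume "Z \<in> carrier ?Q"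
    then obtain d w where "d \<in> carrier R" "w \<in> S" "Z = fraction R S d w" by (meson localization_cases)
    with c show "W \<otimes>\<^bsub>?Q\<^esub> Y \<otimes>\<^bsub>?Q\<^esub> Z = W \<otimes>\<^bsub>?Q\<^esub> (Y \<otimes>\<^bsub>?Q\<^esub> Z)"
      by (simp add: ops S_mult m_ac)
  qed
  fix W Y Z assume "W \<in> carrier ?Q" "Y \<in> carrier ?Q" "Z \<in> carrier ?Q"
  then obtain a s b t d w where c: "a \<in> carrier R" "s \<in> S" "W = fraction R S a s"
      "b \<in> carrier R" "t \<in> S" "Y = fraction R S b t" "d \<in> carrier R" "w \<in> S" "Z = fraction R S d w"
    by (meson localization_cases)
  then show "(W \<oplus>\<^bsub>?Q\<^esub> Y) \<otimes>\<^bsub>?Q\<^esub> Z = W \<otimes>\<^bsub>?Q\<^esub> Z \<oplus>\<^bsub>?Q\<^esub> Y \<otimes>\<^bsub>?Q\<^esub> Z"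
    by (simp add: ops S_mult, intro frac_eqI) (simp_all add: S_mult l_distr r_distr m_ac)
qed

end

lemma nonzerodivisors_mult_set:
  assumes "cring R"
  shows "mult_set R (nonzerodivisors R)"
proof -
  interpret cring R by fact
  show ?thesis
  proof unfold_locales
    show "nonzerodivisors R \<subseteq> carrier R" "\<one>\<^bsub>R\<^esub> \<in> nonzerodivisors R"
      by (auto simp: nonzerodivisors_def)
    fix s t assume st: "s \<in> nonzerodivisors R" "t \<in> nonzerodivisors R"
    then have c: "s \<in> carrier R" "t \<in> carrier R" by (auto simp: nonzerodivisors_def)
    have "r = \<zero>\<^bsub>R\<^esub>" if r: "r \<in> carrier R" "r \<otimes>\<^bsub>R\<^esub> (s \<otimes>\<^bsub>R\<^esub> t) = \<zero>\<^bsub>R\<^esub>" for r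
    proof -
      have "r \<otimes>\<^bsub>R\<^esub> s \<otimes>\<^bsub>R\<^esub> t = \<zero>\<^bsub>R\<^esub>" using r c by (simp add: m_assoc)
      then have "r \<otimes>\<^bsub>R\<^esub> s = \<zero>\<^bsub>R\<^esub>"
        using st(2) r(1) c by (simp add: nonzerodivisors_def)
      then show ?thesis using st(1) r(1) by (simp add: nonzerodivisors_def)
    qed
    then show "s \<otimes>\<^bsub>R\<^esub> t \<in> nonzerodivisors R"
      using c by (simp add: nonzerodivisors_def)
  qed
qed

lemma total_fraction_ring_cring: "cring R \<Longrightarrow> cring (total_fraction_ring R)"
  unfolding total_fraction_ring_def
  by (intro mult_set.localization_cring nonzerodivisors_mult_set)

end

theory Submission
  imports Defs
begin

text \<open>
  The principal ideal \<open>aR\<close> is projective iff \<open>r \<mapsto> ra\<close> splits, that is, iff there is \<open>e\<close> with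
  \<open>ea = a\<close> that is killed by \<open>Ann(a)\<close> (such an \<open>e\<close> is idempotent and \<open>Ann(a) = (1 - e)R\<close>).
  Given \<open>e\<close>, the ideal \<open>Ann(a)\<close> is even pure, and \<open>t = a + 1 - e\<close> is a non-zero-divisor with
  \<open>a\<^sup>2 = at\<close>, which makes every \<open>a/s\<close> regular in \<open>Q(R)\<close>. Conversely, regularity of \<open>a/1\<close>
  provides \<open>b\<close> and a non-zero-divisor \<open>t\<close> with \<open>at = a\<^sup>2b\<close>. Hence \<open>R\<close> is reduced and
  \<open>t - ab \<in> Ann(a)\<close>, so N-purity provides \<open>c \<in> Ann(a)\<close> with \<open>(t - ab)(1 - c) = 0\<close>,
  and \<open>e = 1 - c\<close> is as required.
\<close>

section \<open>Ideals as modules, supports, and projective principal ideals\<close>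

lemma ideal_module:
  assumes "cring R" "ideal I R"
  shows "module R ((regular_module R)\<lparr>carrier := I\<rparr>)"
proof -
  interpret cring R by fact
  interpret ideal I R by fact
  have I: "x \<in> carrier R" if "x \<in> I" for x using that by (rule Icarr)
  show ?thesis
  proof (rule moduleI)
    show "abelian_group ((regular_module R)\<lparr>carrier := I\<rparr>)"
    proof (rule abelian_groupI)
      fix x assume "x \<in> carrier ((regular_module R)\<lparr>carrier := I\<rparr>)"
      then have "x \<in> I" by simp
      then show "\<exists>y\<in>carrier ((regular_module R)\<lparr>carrier := I\<rparr>).
          y \<oplus>\<^bsub>(regular_module R)\<lparr>carrier := I\<rparr>\<^esub> x = \<zero>\<^bsub>(regular_module R)\<lparr>carrier := I\<rparr>\<^esub>"
        by (intro bexI[of _ "\<ominus>\<^bsub>R\<^esub> x"]) (simp_all add: regular_module_def I l_neg)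
    qed (simp_all add: regular_module_def I a_ac)
  qed (simp_all add: regular_module_def I l_distr r_distr m_assoc is_cring I_l_closed)
qed

lemma regular_module_module:
  assumes "cring R"
  shows "module R (regular_module R)"
proof -
  interpret cring R by fact
  have "(regular_module R)\<lparr>carrier := carrier R\<rparr> = regular_module R"
    by (simp add: regular_module_def)
  with ideal_module[OF assms oneideal] show ?thesis by simp
qed

text \<open>An element-level substitute for projectivity of \<open>aR\<close>, free of any
  quantification over modules. As \<open>1 - e\<close> kills \<open>a\<close>, it also kills
  \<open>e\<close>; so \<open>e\<close> is idempotent, and it is the only idempotent with the same
  annihilator as \<open>a\<close>.\<close>

definition is_support :: "('a, 'r) ring_scheme \<Rightarrow> 'a \<Rightarrow> 'a \<Rightarrow> bool"
  where "is_support R a e \<longleftrightarrow> e \<in> carrier R \<and> e \<otimes>\<^bsub>R\<^esub> a = a \<and>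
    (\<forall>r\<in>carrier R. r \<otimes>\<^bsub>R\<^esub> a = \<zero>\<^bsub>R\<^esub> \<longrightarrow> r \<otimes>\<^bsub>R\<^esub> e = \<zero>\<^bsub>R\<^esub>)"

context cring
begin

text \<open>Lifting the identity of \<open>aR\<close> along the surjection
  \<open>r \<mapsto> ra\<close> from \<open>R\<close> yields a section \<open>h\<close>, and
  \<open>h a\<close> is a support of \<open>a\<close>: \<open>r \<otimes> a = \<zero>\<close> forces
  \<open>r \<otimes> h a = h (r \<otimes> a) = \<zero>\<close> by linearity.\<close>

lemma projective_cgenideal_support:
  assumes a: "a \<in> carrier R"
    and P: "projective_module R ((regular_module R)\<lparr>carrier := PIdl a\<rparr>)" (is "projective_module R ?I")
  shows "\<exists>e. is_support R a e"
proof -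
  have mI: "module R ?I" by (rule ideal_module[OF is_cring cgenideal_ideal[OF a]])
  have g: "(\<lambda>r. r \<otimes> a) \<in> mod_hom R (regular_module R) ?I"
    using a by (auto simp: mod_hom_def regular_module_def cgenideal_def l_distr m_assoc)
  have s: "(\<lambda>r. r \<otimes> a) ` carrier (regular_module R) = carrier ?I"
    by (auto simp: regular_module_def cgenideal_def)
  have "(\<lambda>x. x) \<in> mod_hom R ?I ?I" by (auto simp: mod_hom_def)
  \<comment> \<open>The definition of projectivity lifts along modules with elements of type
    \<open>'a \<Rightarrow> 'a\<close>, while those of the regular module have type
    \<open>'a\<close>; hence the lifting lemma for arbitrary types.\<close>
  from projective_module_lift[OF P regular_module_module[OF is_cring] mI g s this]
  obtain h where h: "h \<in> mod_hom R ?I (regular_module R)" and ha: "\<And>x. x \<in> PIdl a \<Longrightarrow> h x \<otimes> a = x"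
    by auto
  have aI: "a \<in> PIdl a" by (rule cgenideal_self[OF a])
  have "r \<otimes> h a = \<zero>" if r: "r \<in> carrier R" "r \<otimes> a = \<zero>" for r
  proof -
    have "r \<otimes> h a = h (r \<otimes> a)"
      using h r(1) aI by (simp add: mod_hom_def regular_module_def)
    also have "\<dots> = \<zero>"
      using mod_hom_zero[OF mI regular_module_module[OF is_cring] h] r(2)
      by (simp add: regular_module_def)
    finally show ?thesis .
  qed
  moreover have "h a \<in> carrier R"
    using h aI by (auto simp: mod_hom_def regular_module_def)
  ultimately have "is_support R a (h a)"
    using ha[OF aI] by (simp add: is_support_def)
  then show ?thesis ..
qed

text \<open>A map \<open>f\<close> from \<open>aR\<close> is lifted by choosing a preimage
  \<open>n\<close> of \<open>f a\<close> and sending \<open>ra\<close> to \<open>(re)n\<close>. The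
  factor \<open>e\<close> makes this independent of \<open>r\<close>, and \<open>ea = a\<close>
  makes it a lift of \<open>f\<close>.\<close>

lemma support_projective_cgenideal:
  assumes a: "a \<in> carrier R" and e: "is_support R a e"
  shows "projective_module R ((regular_module R)\<lparr>carrier := PIdl a\<rparr>)" (is "projective_module R ?I")
  unfolding projective_module_def
proof (intro conjI allI ballI impI)
  show mI: "module R ?I" by (rule ideal_module[OF is_cring cgenideal_ideal[OF a]])
  have ec: "e \<in> carrier R" "e \<otimes> a = a" "\<And>r. r \<in> carrier R \<Longrightarrow> r \<otimes> a = \<zero> \<Longrightarrow> r \<otimes> e = \<zero>"
    using e by (auto simp: is_support_def)
  have wd: "r \<otimes> e = r' \<otimes> e" if "r \<in> carrier R" "r' \<in> carrier R" "r \<otimes> a = r' \<otimes> a" for r r'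
  proof -
    have "(r \<ominus> r') \<otimes> a = \<zero>" using that a by (simp add: minus_eq l_distr l_minus r_neg)
    then have "(r \<ominus> r') \<otimes> e = \<zero>" using ec(3) that by simp
    then have "r \<otimes> e \<ominus> r' \<otimes> e = \<zero>" using that ec(1) by (simp add: minus_eq l_distr l_minus)
    then show ?thesis using that ec(1) r_right_minus_eq by (metis m_closed)
  qed
  fix N :: "('a, 'a \<Rightarrow> 'a) module" and L :: "('a, 'a) module" and g f
  assume g: "g \<in> mod_hom R N L" and f: "f \<in> mod_hom R ?I L"
    and mN: "module R N" and mL: "module R L" and s: "g ` carrier N = carrier L"
  interpret N: module R N by fact
  interpret L: module R L by fact
  have aI: "a \<in> PIdl a" by (rule cgenideal_self[OF a])
  then have fa: "f a \<in> carrier L" using f by (auto simp: mod_hom_def)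
  then obtain n where n: "n \<in> carrier N" "g n = f a" using s by (metis imageE)
  have sm: "f (r \<otimes> x) = r \<odot>\<^bsub>L\<^esub> f x" if "r \<in> carrier R" "x \<in> PIdl a" for r x
    using f that by (simp add: mod_hom_def regular_module_def)
  \<comment> \<open>The coefficient of \<open>x\<close> is chosen arbitrarily; by \<open>wd\<close>
    its product with \<open>e\<close> depends on \<open>x\<close> only.\<close>
  define h where "h x = ((SOME r. r \<in> carrier R \<and> x = r \<otimes> a) \<otimes> e) \<odot>\<^bsub>N\<^esub> n" for x
  have h: "h (r \<otimes> a) = (r \<otimes> e) \<odot>\<^bsub>N\<^esub> n" if r: "r \<in> carrier R" for r
  proof -
    let ?r = "SOME r'. r' \<in> carrier R \<and> r \<otimes> a = r' \<otimes> a"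
    have "?r \<in> carrier R \<and> r \<otimes> a = ?r \<otimes> a"
      by (rule someI[of _ r]) (use r in simp)
    with wd r have "r \<otimes> e = ?r \<otimes> e" by blast
    then show ?thesis by (simp add: h_def)
  qed
  have gh: "g (h (r \<otimes> a)) = f (r \<otimes> a)" if r: "r \<in> carrier R" for r
  proof -
    have "g (h (r \<otimes> a)) = (r \<otimes> e) \<odot>\<^bsub>L\<^esub> f a"
      using g n r ec(1) by (simp add: h mod_hom_def)
    also have "\<dots> = f ((r \<otimes> e) \<otimes> a)" using sm aI r ec(1) by simp
    also have "(r \<otimes> e) \<otimes> a = r \<otimes> a" using r ec a by (simp add: m_assoc)
    finally show ?thesis .
  qed
  show "\<exists>h\<in>mod_hom R ?I N. \<forall>x\<in>carrier ?I. g (h x) = f x"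
  proof (rule bexI)
    show "\<forall>x\<in>carrier ?I. g (h x) = f x"
      using gh by (auto simp: cgenideal_def)
    have "h (x \<oplus> y) = h x \<oplus>\<^bsub>N\<^esub> h y" if "x \<in> PIdl a" "y \<in> PIdl a" for x y
    proof -
      from that obtain r r' where r: "r \<in> carrier R" "x = r \<otimes> a" "r' \<in> carrier R" "y = r' \<otimes> a"
        by (auto simp: cgenideal_def)
      then have "x \<oplus> y = (r \<oplus> r') \<otimes> a" using a by (simp add: l_distr)
      then show ?thesis using r ec(1) n by (simp add: h l_distr N.smult_l_distr)
    qed
    moreover have "h (q \<otimes> x) = q \<odot>\<^bsub>N\<^esub> h x" if "q \<in> carrier R" "x \<in> PIdl a" for q x
    proof -
      from that obtain r where r: "r \<in> carrier R" "x = r \<otimes> a" by (auto simp: cgenideal_def)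
      then have "q \<otimes> x = (q \<otimes> r) \<otimes> a" using a that by (simp add: m_assoc)
      then show ?thesis using r ec(1) n that by (simp add: h m_assoc N.smult_assoc1)
    qed
    moreover have "h x \<in> carrier N" if "x \<in> PIdl a" for x
      using that n ec(1) by (auto simp: cgenideal_def h)
    ultimately show "h \<in> mod_hom R ?I N"
      by (simp add: mod_hom_def regular_module_def)
  qed
qed

lemma pp_ring_iff_support:
  "pp_ring R \<longleftrightarrow> (\<forall>a\<in>carrier R. \<exists>e. is_support R a e)"
proof
  assume "pp_ring R"
  then show "\<forall>a\<in>carrier R. \<exists>e. is_support R a e"
    using projective_cgenideal_support cgenideal_is_principalideal by (auto simp: pp_ring_def)
next
  assume *: "\<forall>a\<in>carrier R. \<exists>e. is_support R a e"
  have "projective_module R ((regular_module R)\<lparr>carrier := I\<rparr>)" if "principalideal I R" for I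
  proof -
    from principalideal.generate[OF that] obtain a where "a \<in> carrier R" "I = PIdl a"
      using cgenideal_eq_genideal by auto
    then show ?thesis using * support_projective_cgenideal by blast
  qed
  then show "pp_ring R" by (simp add: pp_ring_def is_cring)
qed

section \<open>From supports to N-pure annihilators and a regular total ring of fractions\<close>

lemma nonzerodivisorsD:
  "s \<in> nonzerodivisors R \<Longrightarrow> r \<in> carrier R \<Longrightarrow> r \<otimes> s = \<zero> \<Longrightarrow> r = \<zero>"
  by (simp add: nonzerodivisors_def)

lemma ideal_Ann:
  assumes a: "a \<in> carrier R"
  shows "ideal (Ann R a) R"
proof (rule idealI)
  have "x \<otimes> (r \<otimes> a) = \<zero>" if "x \<in> carrier R" "r \<in> carrier R" "x \<otimes> a = \<zero>" for x r
    using m_lcomm[of x r a] that a by simp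
  then show "r \<otimes> x \<in> Ann R a" "x \<otimes> r \<in> Ann R a" if "x \<in> Ann R a" "r \<in> carrier R" for x r
    using that a by (auto simp: Ann_def m_assoc)
  show "subgroup (Ann R a) (add_monoid R)"
    by (rule group.subgroupI[OF a_group])
      (use a in \<open>auto simp: Ann_def l_distr l_minus a_inv_def[symmetric]\<close>)
qed (rule ring_axioms)

lemma is_support_complement:
  assumes "a \<in> carrier R" "is_support R a e"
  shows "\<one> \<ominus> e \<in> Ann R a"
  using assms by (simp add: is_support_def Ann_def minus_eq l_distr l_minus r_neg)

text \<open>The single element \<open>1 - e\<close> of \<open>Ann(a)\<close> is a witness for every
  \<open>x\<close> in \<open>Ann(a)\<close>, because \<open>x(1 - (1 - e)) = xe = 0\<close>.\<close>

lemma is_support_N_pure: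
  assumes a: "a \<in> carrier R" and e: "is_support R a e"
  shows "N_pure R (Ann R a)"
  unfolding N_pure_def
proof (intro conjI ballI)
  show "ideal (Ann R a) R" using a by (rule ideal_Ann)
  fix x assume x: "x \<in> Ann R a"
  have ec: "e \<in> carrier R" using e by (simp add: is_support_def)
  have "\<one> \<ominus> (\<one> \<ominus> e) = e" using ec by algebra
  moreover have "x \<otimes> e = \<zero>" using x e by (simp add: is_support_def Ann_def)
  ultimately have "x \<otimes> (\<one> \<ominus> (\<one> \<ominus> e)) \<in> nilradical R"
    by (simp add: nilradical_def exI[of _ "1::nat"])
  with is_support_complement[OF a e]
  show "\<exists>b\<in>Ann R a. x \<otimes> (\<one> \<ominus> b) \<in> nilradical R" ..
qed

text \<open>The idempotent \<open>e\<close> splits \<open>R\<close> into \<open>eR\<close> and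
  \<open>(1 - e)R\<close>. The element acts as \<open>a\<close> on the first factor, where
  \<open>a\<close> kills only zero, and as \<open>1\<close> on the second.\<close>

lemma is_support_nonzerodivisor:
  assumes a: "a \<in> carrier R" and e: "is_support R a e"
  shows "a \<oplus> (\<one> \<ominus> e) \<in> nonzerodivisors R"
proof -
  have ec: "e \<in> carrier R" "e \<otimes> a = a" "\<And>r. r \<in> carrier R \<Longrightarrow> r \<otimes> a = \<zero> \<Longrightarrow> r \<otimes> e = \<zero>"
    using e by (auto simp: is_support_def)
  have "(\<one> \<ominus> e) \<otimes> e = \<zero>"
    using is_support_complement[OF a e] by (intro ec(3)) (auto simp: Ann_def)
  have "r = \<zero>" if r: "r \<in> carrier R" "r \<otimes> (a \<oplus> (\<one> \<ominus> e)) = \<zero>" for r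
  proof -
    \<comment> \<open>The sum is written with \<open>e \<otimes> a\<close> and the zero term
      \<open>(\<one> \<ominus> e) \<otimes> e\<close> so that the next equality is a polynomial
      identity.\<close>
    have "r \<otimes> a = r \<otimes> (e \<otimes> a) \<oplus> r \<otimes> ((\<one> \<ominus> e) \<otimes> e)"
      using r(1) a ec(1) \<open>(\<one> \<ominus> e) \<otimes> e = \<zero>\<close> ec(2) by simp
    also have "\<dots> = (r \<otimes> (a \<oplus> (\<one> \<ominus> e))) \<otimes> e" using r(1) a ec(1) by algebra
    also have "\<dots> = \<zero>" using r(2) ec(1) by simp
    finally have ra: "r \<otimes> a = \<zero>" .
    have "r = r \<otimes> (a \<oplus> (\<one> \<ominus> e)) \<ominus> r \<otimes> a \<oplus> r \<otimes> e" using r(1) a ec(1) by algebra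
    then show ?thesis using r ra ec(3)[OF r(1) ra] by (simp add: minus_eq)
  qed
  then show ?thesis using a ec(1) by (simp add: nonzerodivisors_def)
qed

lemma pp_ring_total_fraction_ring_regular:
  assumes "pp_ring R"
  shows "von_neumann_regular (total_fraction_ring R)"
  unfolding von_neumann_regular_def
proof (intro conjI ballI)
  show "ring (total_fraction_ring R)"
    using total_fraction_ring_cring[OF is_cring] by (rule cring.axioms)
  let ?S = "nonzerodivisors R"
  interpret S: mult_set R ?S by (rule nonzerodivisors_mult_set[OF is_cring])
  fix W assume "W \<in> carrier (total_fraction_ring R)"
  then obtain a s where W: "a \<in> carrier R" "s \<in> ?S" "W = fraction R ?S a s"
    unfolding total_fraction_ring_def by (rule S.localization_cases)
  obtain e where e: "is_support R a e" using assms W(1) pp_ring_iff_support by blast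
  have ec: "e \<in> carrier R" "e \<otimes> a = a" using e by (auto simp: is_support_def)
  \<comment> \<open>Since \<open>at = aa\<close>, the fraction \<open>s/t\<close> is a quasi-inverse
    of \<open>a/s\<close>.\<close>
  define t where "t = a \<oplus> (\<one> \<ominus> e)"
  have t: "t \<in> ?S" unfolding t_def by (rule is_support_nonzerodivisor[OF W(1) e])
  have "a \<otimes> t = a \<otimes> a \<oplus> a \<ominus> e \<otimes> a" unfolding t_def using W(1) ec(1) by algebra
  then have at: "a \<otimes> t = a \<otimes> a" using W(1) ec(2) by (simp add: minus_eq a_assoc r_neg)
  have "a \<otimes> (s \<otimes> t \<otimes> s) = a \<otimes> t \<otimes> (s \<otimes> s)" using W t by (simp add: m_ac)
  also have "\<dots> = a \<otimes> s \<otimes> a \<otimes> s" unfolding at using W by (simp add: m_ac)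
  finally have "W = fraction R ?S (a \<otimes> s \<otimes> a) (s \<otimes> t \<otimes> s)"
    unfolding W(3) using W(1,2) t by (intro S.frac_eqI) (simp_all add: S.S_mult)
  also have "\<dots> = W \<otimes>\<^bsub>localization R ?S\<^esub> fraction R ?S s t \<otimes>\<^bsub>localization R ?S\<^esub> W"
    unfolding W(3) using W(1,2) t by (simp add: S.localization_mult S.S_mult)
  finally have "W = W \<otimes>\<^bsub>localization R ?S\<^esub> fraction R ?S s t \<otimes>\<^bsub>localization R ?S\<^esub> W" .
  moreover have "fraction R ?S s t \<in> carrier (localization R ?S)" using W t by simp
  ultimately show "\<exists>b\<in>carrier (total_fraction_ring R).
      W = W \<otimes>\<^bsub>total_fraction_ring R\<^esub> b \<otimes>\<^bsub>total_fraction_ring R\<^esub> W"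
    unfolding total_fraction_ring_def by blast
qed

section \<open>From a regular total ring of fractions and N-pure annihilators to supports\<close>

lemma total_fraction_ring_regularD:
  assumes "von_neumann_regular (total_fraction_ring R)" and a: "a \<in> carrier R"
  obtains b t where "b \<in> carrier R" "t \<in> nonzerodivisors R" "a \<otimes> t = a \<otimes> a \<otimes> b"
proof -
  let ?S = "nonzerodivisors R"
  interpret S: mult_set R ?S by (rule nonzerodivisors_mult_set[OF is_cring])
  note [simp] = S.S_one S.S_mult
  let ?a = "fraction R ?S a \<one>"
  have "?a \<in> carrier (localization R ?S)" using a by simp
  with assms(1) obtain W where "W \<in> carrier (localization R ?S)"
      and eq: "?a = ?a \<otimes>\<^bsub>localization R ?S\<^esub> W \<otimes>\<^bsub>localization R ?S\<^esub> ?a"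
    unfolding von_neumann_regular_def total_fraction_ring_def by blast
  then obtain b t where W: "b \<in> carrier R" "t \<in> ?S" "W = fraction R ?S b t"
    by (meson S.localization_cases)
  then have "?a = fraction R ?S (a \<otimes> b \<otimes> a) t"
    using eq a by (simp add: S.localization_mult)
  then obtain u where u: "u \<in> ?S" "u \<otimes> (a \<otimes> t) = u \<otimes> (a \<otimes> b \<otimes> a)"
    using a W by (subst (asm) S.frac_eq_iff) auto
  \<comment> \<open>Equality of fractions holds in \<open>R\<close> only up to a factor
    \<open>u\<close>; as a non-zero-divisor it can be cancelled.\<close>
  have "(a \<otimes> t \<ominus> a \<otimes> b \<otimes> a) \<otimes> u = u \<otimes> (a \<otimes> t) \<ominus> u \<otimes> (a \<otimes> b \<otimes> a)"
    using a W(1) S.S_carrier[OF u(1)] S.S_carrier[OF W(2)] by algebra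
  also have "\<dots> = \<zero>" using u a W(1,2) by (simp add: minus_eq r_neg)
  finally have "a \<otimes> t \<ominus> a \<otimes> b \<otimes> a = \<zero>"
    by (rule nonzerodivisorsD[OF u(1), rotated]) (use a W(1,2) in simp)
  then have "a \<otimes> t = a \<otimes> b \<otimes> a"
    using a W(1,2) by (simp add: r_right_minus_eq)
  then show ?thesis using that W a by (simp add: m_ac)
qed

text \<open>Regularity of \<open>x/1\<close> trades a factor \<open>x\<close> for a non-zero-divisor
  \<open>t\<close>: \<open>xt\<close> is a multiple of \<open>xx\<close>. So if a power of
  \<open>x\<close> with exponent at least 2 vanishes, the preceding power vanishes too.\<close>

lemma total_fraction_ring_regular_reduced:
  assumes "von_neumann_regular (total_fraction_ring R)" and "x \<in> nilradical R"
  shows "x = \<zero>"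
proof -
  have x: "x \<in> carrier R" and "\<exists>n::nat. x [^] n = \<zero>"
    using assms(2) by (auto simp: nilradical_def)
  then obtain n :: nat where "x [^] n = \<zero>" by blast
  \<comment> \<open>The given exponent may be 0, when \<open>R\<close> is trivial; raising it by one
    lets the descent end at exponent 1.\<close>
  then have "x [^] Suc n = \<zero>" using x by simp
  then show ?thesis
  proof (induction n)
    case 0
    then show ?case using x by simp
  next
    case (Suc n)
    obtain b t where bt: "b \<in> carrier R" "t \<in> nonzerodivisors R" "x \<otimes> t = x \<otimes> x \<otimes> b"
      using total_fraction_ring_regularD[OF assms(1) x] .
    then have t: "t \<in> carrier R" by (simp add: nonzerodivisors_def)
    have "x [^] Suc n \<otimes> t = x [^] n \<otimes> (x \<otimes> t)" using x t by (simp add: m_assoc)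
    also have "\<dots> = x [^] Suc (Suc n) \<otimes> b" unfolding bt(3) using x bt(1) by (simp add: m_assoc)
    also have "\<dots> = \<zero>" using Suc.prems bt(1) by simp
    finally have "x [^] Suc n = \<zero>" 
      by (rule nonzerodivisorsD[OF bt(2), rotated]) (use x in simp)
    then show ?case by (rule Suc.IH)
  qed
qed

lemma mid_ring_regular_support:
  assumes mid: "mid_ring R" and reg: "von_neumann_regular (total_fraction_ring R)"
    and a: "a \<in> carrier R"
  shows "\<exists>e. is_support R a e"
proof -
  obtain b t where bt: "b \<in> carrier R" "t \<in> nonzerodivisors R" "a \<otimes> t = a \<otimes> a \<otimes> b"
    using total_fraction_ring_regularD[OF reg a] .
  then have t: "t \<in> carrier R" by (simp add: nonzerodivisors_def)
  have "(t \<ominus> a \<otimes> b) \<otimes> a = a \<otimes> t \<ominus> a \<otimes> a \<otimes> b" using a t bt(1) by algebra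
  also have "\<dots> = \<zero>" unfolding bt(3) using a bt(1) by (simp add: minus_eq r_neg)
  finally have "t \<ominus> a \<otimes> b \<in> Ann R a" using a t bt(1) by (simp add: Ann_def)
  then obtain c where c: "c \<in> Ann R a" "(t \<ominus> a \<otimes> b) \<otimes> (\<one> \<ominus> c) \<in> nilradical R"
    using mid a by (auto simp: mid_ring_def N_pure_def)
  then have cc: "c \<in> carrier R" "c \<otimes> a = \<zero>" by (auto simp: Ann_def)
  \<comment> \<open>As \<open>R\<close> is reduced, the condition modulo the nil-radical becomes an
    equation.\<close>
  have z: "(t \<ominus> a \<otimes> b) \<otimes> (\<one> \<ominus> c) = \<zero>"
    by (rule total_fraction_ring_regular_reduced[OF reg c(2)])
  have "(\<one> \<ominus> c) \<otimes> a = a \<ominus> c \<otimes> a" using a cc(1) by algebra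
  then have "(\<one> \<ominus> c) \<otimes> a = a" using a cc(2) by (simp add: minus_eq)
  moreover have "r \<otimes> (\<one> \<ominus> c) = \<zero>" if r: "r \<in> carrier R" "r \<otimes> a = \<zero>" for r
  proof (rule nonzerodivisorsD[OF bt(2)])
    \<comment> \<open>Splitting \<open>t\<close> as \<open>(t - ab) + ab\<close> leaves one summand
      killed by \<open>z\<close> and one by \<open>ra = 0\<close>; then \<open>t\<close> is
      cancelled.\<close>
    have "r \<otimes> (\<one> \<ominus> c) \<otimes> t
        = r \<otimes> ((t \<ominus> a \<otimes> b) \<otimes> (\<one> \<ominus> c)) \<oplus> (r \<otimes> a) \<otimes> (b \<otimes> (\<one> \<ominus> c))"
      using r(1) a t bt(1) cc(1) by algebra
    also have "\<dots> = \<zero>" unfolding z r(2) using r(1) bt(1) cc(1) by simp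
    finally show "r \<otimes> (\<one> \<ominus> c) \<otimes> t = \<zero>" .
  qed (use r cc in simp)
  ultimately have "is_support R a (\<one> \<ominus> c)"
    using cc(1) by (simp add: is_support_def)
  then show ?thesis ..
qed

end

theorem theorem4p11:
  fixes R :: "('a, 'r) ring_scheme"
  assumes "cring R"
  shows "pp_ring R \<longleftrightarrow> mid_ring R \<and> von_neumann_regular (total_fraction_ring R)"
proof -
  interpret cring R by fact
  show ?thesis
  proof
    assume pp: "pp_ring R"
    then have "mid_ring R"
      using is_support_N_pure pp_ring_iff_support by (auto simp: mid_ring_def is_cring)
    with pp show "mid_ring R \<and> von_neumann_regular (total_fraction_ring R)"
      using pp_ring_total_fraction_ring_regular by blast
  next
    assume "mid_ring R \<and> von_neumann_regular (total_fraction_ring R)"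
    then show "pp_ring R" using pp_ring_iff_support mid_ring_regular_support by blast
  qed
qed

end
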